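(* For $m\ge 2$, $sn(f_m)=m$, where $f_m$ is the friendship graph.
   Context: Graphs are finite, undirected and simple. The friendship graph $f_m$, $m\ge 2$, is the graph obtained from $m$ disjoint triangles $K_3$ by choosing one vertex in each and identifying these $m$ vertices into a single common vertex (so it has $2m+1$ vertices). Let $G=(V,E)$ be a connected graph with chromatic number $\chi(G)=k\ge 2$. For $S\subset V$, a partial coloring on $G[S]$ is a proper coloring $\mathscr C_0$ of the induced subgraph $G[S]$ with colors from $\{1,\dots,k\}$ (not all colors need be used). It is a Sudoku coloring of $G$ if there is exactly one proper $k$-coloring $V\to\{1,\dots,k\}$ of $G$ whose restriction to $S$ is $\mathscr C_0$. The Sudoku number $sn(G)$ is the smallest $|S|$ such that $G[S]$ admits a Sudoku coloring of $G$. *)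

theory Defs
  imports "Graph_Theory.Graph_Theory" "HOL-Library.FuncSet"
begin

text \<open>
  Undirected simple graphs are the symmetric loop-free digraphs of the locale
  \<^locale>\<open>graph\<close>. Colorings are extensional functions on the vertex set, so that
  two colorings are equal iff they agree on all vertices.
\<close>

definition proper_coloring :: "('a, 'b) pre_digraph \<Rightarrow> nat \<Rightarrow> ('a \<Rightarrow> nat) \<Rightarrow> bool" where
  "proper_coloring G k c \<longleftrightarrow>
     c \<in> verts G \<rightarrow>\<^sub>E {1..k} \<and> (\<forall>u v. u \<rightarrow>\<^bsub>G\<^esub> v \<longrightarrow> c u \<noteq> c v)"

definition chromatic_number :: "('a, 'b) pre_digraph \<Rightarrow> nat" where
  "chromatic_number G = (LEAST k. \<exists>c. proper_coloring G k c)"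

definition sudoku_coloring :: "('a, 'b) pre_digraph \<Rightarrow> 'a set \<Rightarrow> ('a \<Rightarrow> nat) \<Rightarrow> bool" where
  "sudoku_coloring G S c\<^sub>0 \<longleftrightarrow>
     S \<subseteq> verts G \<and>
     proper_coloring (G \<restriction> S) (chromatic_number G) c\<^sub>0 \<and>
     (\<exists>!c. proper_coloring G (chromatic_number G) c \<and> restrict c S = c\<^sub>0)"

text \<open>
  Meaningful for finite loop-free graphs: there a coloring with
  \<^term>\<open>chromatic_number G\<close> colors exists and is a Sudoku coloring on the whole
  vertex set, so the minimum is attained.
\<close>

definition sudoku_number :: "('a, 'b) pre_digraph \<Rightarrow> nat" where
  "sudoku_number G = (LEAST n. \<exists>S c\<^sub>0. sudoku_coloring G S c\<^sub>0 \<and> card S = n)"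

text \<open>The vertices of the \<open>i\<close>-th triangle are \<open>(i, 0)\<close>, \<open>(i, 1)\<close>, \<open>(i, 2)\<close>.\<close>

definition disjoint_triangles :: "nat \<Rightarrow> (nat \<times> nat) pair_pre_digraph" where
  "disjoint_triangles m =
     \<lparr> pverts = {..<m} \<times> {..<3},
       parcs = {((i, a), (i, b)) |i a b. i < m \<and> a < 3 \<and> b < 3 \<and> a \<noteq> b} \<rparr>"

text \<open>The vertices \<open>(i, 0)\<close>, one from each triangle, are identified, with representative \<open>(0, 0)\<close>.\<close>

definition identify_centers :: "nat \<times> nat \<Rightarrow> nat \<times> nat" where
  "identify_centers v = (if snd v = 0 then (0, 0) else v)"

definition friendship_graph :: "nat \<Rightarrow> (nat \<times> nat) pair_pre_digraph" where
  "friendship_graph m =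
     \<lparr> pverts = identify_centers ` pverts (disjoint_triangles m),
       parcs = map_prod identify_centers identify_centers ` parcs (disjoint_triangles m) \<rparr>"

lemma pverts_friendship_graph:
  assumes "m \<ge> 1"
  shows "pverts (friendship_graph m) = insert (0, 0) ({..<m} \<times> {1, 2})"
proof -
  have "{..<3::nat} = {0, 1, 2}" by auto
  then show ?thesis
    using assms
    by (fastforce simp: friendship_graph_def disjoint_triangles_def identify_centers_def image_iff)
qed

lemma card_pverts_friendship_graph:
  assumes "m \<ge> 1"
  shows "card (pverts (friendship_graph m)) = 2 * m + 1"
  using assms by (simp add: pverts_friendship_graph card_cartesian_product)

lemma graph_friendship_graph: "graph (with_proj (friendship_graph m))"
proof -
  have fin: "finite (parcs (disjoint_triangles m))"
    by (rule finite_subset[of _ "({..<m} \<times> {..<3}) \<times> ({..<m} \<times> {..<3})"])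
      (auto simp: disjoint_triangles_def)
  have "pair_graph (friendship_graph m)"
  proof unfold_locales
    show "finite (parcs (friendship_graph m))"
      using fin by (simp add: friendship_graph_def)
    show "finite (pverts (friendship_graph m))"
      by (simp add: friendship_graph_def disjoint_triangles_def)
    show "symmetric (with_proj (friendship_graph m))"
      unfolding symmetric_def
      by (rule symI) (fastforce simp: friendship_graph_def disjoint_triangles_def image_iff map_prod_def)
  qed (force simp: friendship_graph_def disjoint_triangles_def identify_centers_def split: if_splits)+
  then show ?thesis by (rule pair_graph.pair_graphD_graph)
qed

lemma parcs_friendship_graph:
  "parcs (friendship_graph m) =
     {(u, v). u \<in> pverts (friendship_graph m) \<and> v \<in> pverts (friendship_graph m) \<and> u \<noteq> v \<and>
        (u = (0, 0) \<or> v = (0, 0) \<or> fst u = fst v)}"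
  (is "?L = ?R")
proof
  show "?L \<subseteq> ?R"
    unfolding friendship_graph_def disjoint_triangles_def
    by (auto intro!: imageI) (auto simp: identify_centers_def split: if_splits)
  show "?R \<subseteq> ?L"
  proof (rule subrelI)
    fix u v assume uv: "(u, v) \<in> ?R"
    obtain i a j b where u: "u = (i, a)" and v: "v = (j, b)" by (metis surj_pair)
    have ne: "(i, a) \<noteq> (j, b)" and adj: "(i, a) = (0, 0) \<or> (j, b) = (0, 0) \<or> i = j"
      using uv unfolding u v by auto
    have *: "i < m" "a < 3" "j < m" "b < 3" "a = 0 \<Longrightarrow> i = 0" "b = 0 \<Longrightarrow> j = 0"
      using uv unfolding u v
      by (auto simp: friendship_graph_def disjoint_triangles_def identify_centers_def split: if_splits)
    define k where "k = (if a = 0 then j else i)"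
    have "((k, a), (k, b)) \<in> parcs (disjoint_triangles m)"
      using * ne adj by (auto simp: k_def disjoint_triangles_def)
    moreover have "map_prod identify_centers identify_centers ((k, a), (k, b)) = ((i, a), (j, b))"
      using * ne adj by (auto simp: k_def identify_centers_def)
    ultimately show "(u, v) \<in> parcs (friendship_graph m)"
      unfolding u v friendship_graph_def by (metis image_eqI pair_pre_digraph.select_convs(2))
  qed
qed

lemma connected_friendship_graph:
  assumes "m \<ge> 1"
  shows "connected (with_proj (friendship_graph m))"
proof -
  let ?F = "with_proj (friendship_graph m)"
  interpret graph ?F by (rule graph_friendship_graph)
  have hub: "(0, 0) \<in> verts ?F" using assms by (simp add: pverts_friendship_graph)
  have "u \<rightarrow>\<^sup>*\<^bsub>?F\<^esub> (0, 0) \<and> (0, 0) \<rightarrow>\<^sup>*\<^bsub>?F\<^esub> u" if u: "u \<in> verts ?F" for u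
  proof (cases "u = (0, 0)")
    case True
    then show ?thesis using hub by (simp add: reachable_refl)
  next
    case False
    then have "(u, (0, 0)) \<in> arcs_ends ?F" "((0, 0), u) \<in> arcs_ends ?F"
      using u hub by (auto simp: parcs_friendship_graph)
    then show ?thesis using reachable_adjI by blast
  qed
  then have "strongly_connected ?F"
    using hub reachable_trans by (intro strongly_connectedI) blast+
  then show ?thesis by (auto simp: connected_conv strongly_connected_def reachable_def symcl_def intro: rtrancl_on_mono)
qed

lemma chromatic_number_friendship_graph:
  assumes "m \<ge> 1"
  shows "chromatic_number (with_proj (friendship_graph m)) = 3"
proof -
  let ?F = "with_proj (friendship_graph m)"
  note simps = proper_coloring_def parcs_friendship_graph pverts_friendship_graph[OF assms]
  have "proper_coloring ?F 3 (restrict (\<lambda>v. snd v + 1) (verts ?F))"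
    by (auto simp: simps)
  moreover have "3 \<le> k" if "proper_coloring ?F k c" for k c
  proof -
    let ?T = "{(0, 0), (0, 1), (0, 2)} :: (nat \<times> nat) set"
    have T: "?T \<subseteq> verts ?F" using assms by (auto simp: pverts_friendship_graph)
    have "inj_on c ?T"
      using that assms by (auto simp: inj_on_def simps)
    moreover have "c ` ?T \<subseteq> {1..k}"
      using that T by (auto simp: proper_coloring_def)
    ultimately have "card ?T \<le> card {1..k}" by (intro card_inj_on_le) auto
    then show ?thesis by simp
  qed
  ultimately show ?thesis
    unfolding chromatic_number_def by (intro Least_equality) blast+
qed

end

theory Submission
  imports Defs
begin

text \<open>
  Exchanging the two non-central vertices of a triangle is an automorphism, so a Sudoku coloring must
  prescribe the color of a non-central vertex in every triangle; hence at least \<open>m\<close> vertices are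
  needed. Conversely, prescribe one non-central vertex per triangle, using two different colors: this
  forces the color of the center, and then that of the third vertex of each triangle.
\<close>

text \<open>Turns the symmetric arc condition into three inequalities per triangle, the form in
  which both bounds use properness.\<close>

lemma proper_coloring_friendship_graph:
  assumes "m \<ge> 1"
  shows "proper_coloring (with_proj (friendship_graph m)) k c \<longleftrightarrow>
    c \<in> insert (0, 0) ({..<m} \<times> {1, 2}) \<rightarrow>\<^sub>E {1..k} \<and>
    (\<forall>i<m. c (0, 0) \<noteq> c (i, 1) \<and> c (0, 0) \<noteq> c (i, 2) \<and> c (i, 1) \<noteq> c (i, 2))"
  unfolding proper_coloring_def
  using assms by (auto simp: parcs_friendship_graph pverts_friendship_graph)

lemma sudoku_coloring_meets_triangle:
  assumes "m \<ge> 1" "i < m"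
    and sud: "sudoku_coloring (with_proj (friendship_graph m)) S c\<^sub>0"
  shows "(i, 1) \<in> S \<or> (i, 2) \<in> S"
proof (rule ccontr)
  let ?F = "with_proj (friendship_graph m)"
  let ?k = "chromatic_number ?F"
  note proper = proper_coloring_friendship_graph[OF \<open>m \<ge> 1\<close>]
  assume "\<not> ((i, 1) \<in> S \<or> (i, 2) \<in> S)"
  then have nS: "(i, 1) \<notin> S" "(i, 2) \<notin> S" by auto
  from sud obtain c where c: "proper_coloring ?F ?k c" "restrict c S = c\<^sub>0"
    and uniq: "\<And>d. proper_coloring ?F ?k d \<Longrightarrow> restrict d S = c\<^sub>0 \<Longrightarrow> d = c"
    unfolding sudoku_coloring_def by blast
  \<comment> \<open>This is \<open>c\<close> composed with the automorphism exchanging the two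
    non-central vertices of triangle \<open>i\<close>. It agrees with \<open>c\<close> on
    \<open>S\<close>, which contains neither vertex, yet differs from \<open>c\<close> because
    adjacent vertices have different colors.\<close>
  let ?d = "c((i, 1) := c (i, 2), (i, 2) := c (i, 1))"
  have ne: "c (i, 1) \<noteq> c (i, 2)"
    using c(1) \<open>i < m\<close> by (simp add: proper)
  have "proper_coloring ?F ?k ?d"
    using c(1) \<open>i < m\<close> unfolding proper by (auto simp: PiE_iff extensional_def)
  moreover have "restrict ?d S = c\<^sub>0"
    unfolding c(2)[symmetric] using nS by (intro restrict_ext) auto
  ultimately have "?d = c" by (rule uniq)
  then show False
    using ne by (metis fun_upd_same)
qed

lemma le_card_sudoku_coloring:
  assumes "m \<ge> 1" "sudoku_coloring (with_proj (friendship_graph m)) S c\<^sub>0"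
  shows "m \<le> card S"
proof -
  have "S \<subseteq> insert (0, 0) ({..<m} \<times> {1, 2})"
    using assms by (simp add: sudoku_coloring_def pverts_friendship_graph)
  then have "finite S" by (rule finite_subset) simp
  \<comment> \<open>A vertex of \<open>S\<close> found in triangle \<open>i\<close> projects to
    \<open>i\<close>, so \<open>S\<close> maps onto the set of indices.\<close>
  moreover have "{..<m} \<subseteq> fst ` S"
    using sudoku_coloring_meets_triangle[OF assms(1) _ assms(2)] by force
  ultimately have "card {..<m} \<le> card S" by (rule surj_card_le)
  then show ?thesis by simp
qed

lemma sudoku_coloring_friendship_graph:
  assumes "m \<ge> 2"
  shows "sudoku_coloring (with_proj (friendship_graph m)) ({..<m} \<times> {1})
    (restrict (\<lambda>v. if v = (0, 1) then 1 else 2) ({..<m} \<times> {1}))"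
    (is "sudoku_coloring ?F ?S ?c0")
proof -
  have m: "m \<ge> 1" using assms by simp
  note proper = proper_coloring_friendship_graph[OF m]
  \<comment> \<open>The forced extension: the center gets 3, triangle 0 gets 1, 2 and every other
    triangle gets 2, 1.\<close>
  define C :: "nat \<times> nat \<Rightarrow> nat" where
    "C = restrict (\<lambda>v. if v = (0, 0) then 3 else if v = (0, 1) \<or> fst v \<noteq> 0 \<and> snd v = 2 then 1 else 2)
      (insert (0, 0) ({..<m} \<times> {1, 2}))"
  have "?S \<subseteq> verts ?F"
    using m by (auto simp: pverts_friendship_graph)
  \<comment> \<open>\<open>?S\<close> is independent: its vertices are non-central and lie in
    distinct triangles.\<close>
  moreover have "proper_coloring (?F \<restriction> ?S) 3 ?c0"
    by (auto simp: proper_coloring_def induce_subgraph_def arcs_ends_def arc_to_ends_def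
        parcs_friendship_graph)
  moreover have "proper_coloring ?F 3 C"
    unfolding proper by (auto simp: C_def)
  moreover have "restrict C ?S = ?c0"
    by (auto simp: C_def fun_eq_iff)
  moreover have "c = C" if c: "proper_coloring ?F 3 c" "restrict c ?S = ?c0" for c
  proof -
    have out: "c (i, 1) = (if i = 0 then 1 else 2)" if "i < m" for i
      using fun_cong[OF c(2), of "(i, 1)"] that by simp
    have dom: "c \<in> insert (0, 0) ({..<m} \<times> {1, 2}) \<rightarrow>\<^sub>E {1..3}"
      and tri: "\<And>i. i < m \<Longrightarrow> c (0, 0) \<noteq> c (i, 1) \<and> c (0, 0) \<noteq> c (i, 2) \<and> c (i, 1) \<noteq> c (i, 2)"
      using c(1) unfolding proper by blast+
    have "c (0, 0) \<in> {1..3}" using dom by blast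
    \<comment> \<open>Here \<open>m \<ge> 2\<close> enters: the center has neighbors
      \<open>(0, 1)\<close> and \<open>(1, 1)\<close> of colors 1 and 2.\<close>
    then have hub: "c (0, 0) = 3"
      using out[of 0] out[of 1] tri[of 0] tri[of 1] assms by auto
    have third: "c (i, 2) = (if i = 0 then 2 else 1)" if "i < m" for i
    proof -
      have "c (i, 2) \<in> {1..3}" using dom that by blast
      \<comment> \<open>The other two vertices of the triangle use color 3 and one of 1 and 2, which
        leaves a single color.\<close>
      then show ?thesis using out[OF that] tri[OF that] hub by (auto split: if_splits)
    qed
    show ?thesis
    proof (rule PiE_ext[OF dom])
      show "C \<in> insert (0, 0) ({..<m} \<times> {1, 2}) \<rightarrow>\<^sub>E {1..3}"
        by (auto simp: C_def)
      show "c v = C v" if "v \<in> insert (0, 0) ({..<m} \<times> {1, 2})" for v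
        using that out third hub by (auto simp: C_def)
    qed
  qed
  ultimately show ?thesis
    unfolding sudoku_coloring_def chromatic_number_friendship_graph[OF m] by blast
qed

theorem corollary3p7:
  fixes m :: nat
  assumes "m \<ge> 2"
  shows "sudoku_number (with_proj (friendship_graph m)) = m"
  unfolding sudoku_number_def
proof (rule Least_equality)
  show "\<exists>S c\<^sub>0. sudoku_coloring (with_proj (friendship_graph m)) S c\<^sub>0 \<and> card S = m"
    by (intro exI conjI, rule sudoku_coloring_friendship_graph[OF assms])
      (simp add: card_cartesian_product)
  show "m \<le> n"
    if "\<exists>S c\<^sub>0. sudoku_coloring (with_proj (friendship_graph m)) S c\<^sub>0 \<and> card S = n" for n
    using that le_card_sudoku_coloring assms by force
qed

end
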